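(* Let $\epsilon\in\mathbb{R}$. Suppose that in the quantum winning strategy for the Mermin-GHZ game Alice (player 1) performs the Hadamard transformation $H$ imperfectly with systematic error $\epsilon$ (i.e. she applies $H_\epsilon$ in place of $H$), all other steps being performed correctly. Then for any inputs $x_1,x_2,x_3\in\{0,1\}$ satisfying the promise $x_1\oplus x_2\oplus x_3=0$, the strategy gives a correct answer with probability $$P_{\epsilon}(x_1,x_2,x_3)=\frac12+\sin\left(\frac{\pi}{4}+\frac{\epsilon}{2}\right)\cos\left(\frac{\pi}{4}+\frac{\epsilon}{2}\right).$$ Moreover, for a question $(x_1,x_2,x_3)$ chosen uniformly at random from the promise set $P$, it gives a correct answer with probability $$P_{\epsilon}=\frac12+\sin\left(\frac{\pi}{4}+\frac{\epsilon}{2}\right)\cos\left(\frac{\pi}{4}+\frac{\epsilon}{2}\right).$$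
   Context: Mermin-GHZ game: three players, Alice, Bob and Charles (players 1, 2, 3), receive input bits $x_1,x_2,x_3\in\{0,1\}$ respectively, with the promise that $(x_1,x_2,x_3)\in P=\{(x_1,x_2,x_3)\in\{0,1\}^3 : x_1\oplus x_2\oplus x_3=0\}$. Without communicating, they output bits $a_1,a_2,a_3$ respectively. The answer is correct if $a_1\oplus a_2\oplus a_3=x_1\lor x_2\lor x_3$. Quantum winning strategy: the players share the three-qubit state $|\varphi\rangle=\frac{1}{\sqrt2}(|000\rangle+|111\rangle)$, player $i$ holding the $i$-th qubit. On input $x_i$, player $i$ (1) applies to his or her qubit the unitary $U$ given by $U|0\rangle=|0\rangle$, $U|1\rangle=e^{\pi \imath x_i/2}|1\rangle$; (2) applies the Hadamard transformation $H=\frac{1}{\sqrt2}\begin{pmatrix}1&1\\1&-1\end{pmatrix}$; (3) measures the qubit in the computational basis and outputs the measured bit $a_i$. Here $\imath$ is the imaginary unit. Systematic error $\epsilon$ in Alice's Hadamard transformation: $\epsilon$ is a constant and Alice applies, in step (2), instead of $H$ the unitary $$H_\epsilon=\begin{pmatrix}\cos(\frac{\pi}{4}+\frac{\epsilon}{2}) & \sin(\frac{\pi}{4}+\frac{\epsilon}{2})\\ \sin(\frac{\pi}{4}+\frac{\epsilon}{2}) & -\cos(\frac{\pi}{4}+\frac{\epsilon}{2})\end{pmatrix}$$ (matrix in the computational basis $|0\rangle,|1\rangle$); everything else is unchanged. *)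

theory Defs
  imports "HOL-Probability.Probability"
begin

text \<open>
  Bits are booleans (False is 0, True is 1). A matrix or state over a register of qubits is
  indexed by the computational basis: bool for one qubit and bool \<times> bool \<times> bool
  for three, the components belonging to Alice, Bob and Charles in this order.
\<close>

definition bxor :: "bool \<Rightarrow> bool \<Rightarrow> bool" (infixl "[+]" 65)
  where "a [+] b \<longleftrightarrow> a \<noteq> b"

definition promise :: "(bool \<times> bool \<times> bool) set"
  where "promise = {(x1, x2, x3). \<not> (x1 [+] x2 [+] x3)}"

definition correct :: "bool \<times> bool \<times> bool \<Rightarrow> bool \<times> bool \<times> bool \<Rightarrow> bool"
  where "correct = (\<lambda>(x1, x2, x3) (a1, a2, a3). (a1 [+] a2 [+] a3) = (x1 \<or> x2 \<or> x3))"

definition tensor :: "complex^'b^'a \<Rightarrow> complex^'d^'c \<Rightarrow> complex^('b \<times> 'd)^('a \<times> 'c)"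
    (infixr "\<otimes>" 75)
  where "A \<otimes> B = (\<chi> r s. A $ fst r $ fst s * B $ snd r $ snd s)"

abbreviation ket :: "'n \<Rightarrow> complex^'n"
  where "ket b \<equiv> axis b 1"

definition ghz :: "complex^(bool \<times> bool \<times> bool)"
  where "ghz = (1 / sqrt 2) *\<^sub>R (ket (False, False, False) + ket (True, True, True))"

definition phase :: "bool \<Rightarrow> complex^bool^bool"
  where "phase x = (\<chi> i j. if i \<noteq> j then 0 else if i then exp (pi * \<i> * of_bool x / 2) else 1)"

definition hadamard :: "complex^bool^bool"
  where "hadamard = (\<chi> i j. (if i \<and> j then - 1 else 1) / sqrt 2)"

definition hadamard_err :: "real \<Rightarrow> complex^bool^bool"
  where "hadamard_err \<epsilon> = (\<chi> i j.
    if i = j then (if i then - 1 else 1) * cos (pi / 4 + \<epsilon> / 2) else sin (pi / 4 + \<epsilon> / 2))"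

text \<open>
  Born rule for measuring every qubit in the computational basis; meaningful for unit vectors
  only (see \<open>pmf_measurement\<close>), since otherwise \<open>embed_pmf\<close> is unspecified.
\<close>

definition measurement :: "complex^'n \<Rightarrow> 'n pmf"
  where "measurement \<psi> = embed_pmf (\<lambda>a. (cmod (\<psi> $ a))\<^sup>2)"

definition final_state ::
    "complex^bool^bool \<Rightarrow> complex^bool^bool \<Rightarrow> complex^bool^bool \<Rightarrow>
     bool \<times> bool \<times> bool \<Rightarrow> complex^(bool \<times> bool \<times> bool)"
  where "final_state H1 H2 H3 = (\<lambda>(x1, x2, x3).
    (H1 \<otimes> H2 \<otimes> H3) *v ((phase x1 \<otimes> phase x2 \<otimes> phase x3) *v ghz))"

text \<open>
  The joint distribution of the answers to a question when the three players use the given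
  matrices in the Hadamard step. The error-free strategy is \<open>strategy hadamard hadamard hadamard\<close>.
\<close>

definition strategy ::
    "complex^bool^bool \<Rightarrow> complex^bool^bool \<Rightarrow> complex^bool^bool \<Rightarrow>
     bool \<times> bool \<times> bool \<Rightarrow> (bool \<times> bool \<times> bool) pmf"
  where "strategy H1 H2 H3 x = measurement (final_state H1 H2 H3 x)"

definition win_prob :: "(bool \<times> bool \<times> bool \<Rightarrow> (bool \<times> bool \<times> bool) pmf) \<Rightarrow>
    bool \<times> bool \<times> bool \<Rightarrow> real"
  where "win_prob S x = measure_pmf.prob (S x) {a. correct x a}"

definition win_prob_uniform ::
    "(bool \<times> bool \<times> bool \<Rightarrow> (bool \<times> bool \<times> bool) pmf) \<Rightarrow> real"
  where "win_prob_uniform S = measure_pmf.prob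
    (bind_pmf (pmf_of_set promise) (\<lambda>x. map_pmf (\<lambda>a. (x, a)) (S x)))
    {(x, a). correct x a}"

lemma pmf_measurement:
  assumes "norm \<psi> = 1"
  shows "pmf (measurement \<psi>) a = (cmod (\<psi> $ a))\<^sup>2"
proof -
  have "(\<Sum>a\<in>UNIV. (cmod (\<psi> $ a))\<^sup>2) = 1"
    using assms by (simp add: norm_vec_def L2_set_def)
  then have "(\<integral>\<^sup>+ a. ennreal ((cmod (\<psi> $ a))\<^sup>2) \<partial>count_space UNIV) = 1"
    by (simp add: nn_integral_count_space_finite sum_ennreal)
  then show ?thesis
    unfolding measurement_def by (intro pmf_embed_pmf) auto
qed

lemma hadamard_err_0: "hadamard_err 0 = hadamard"
  by (simp add: hadamard_err_def hadamard_def vec_eq_iff cos_45 sin_45 complex_eq_iff real_div_sqrt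
      field_simps)

lemma sum_UNIV_bool3:
  "(\<Sum>a\<in>UNIV. f a) = (\<Sum>a1\<in>UNIV. \<Sum>a2\<in>UNIV. \<Sum>a3\<in>UNIV. f (a1, a2, a3))"
  for f :: "bool \<times> bool \<times> bool \<Rightarrow> 'a::comm_monoid_add"
  by (simp add: sum.cartesian_product case_prod_unfold)

lemma final_state_nth:
  "final_state H1 H2 H3 (x1, x2, x3) $ (a1, a2, a3) =
    (H1 $ a1 $ False * H2 $ a2 $ False * H3 $ a3 $ False +
     exp (pi * \<i> * of_bool x1 / 2) * exp (pi * \<i> * of_bool x2 / 2) * exp (pi * \<i> * of_bool x3 / 2) *
     (H1 $ a1 $ True * H2 $ a2 $ True * H3 $ a3 $ True)) / sqrt 2"
  by (simp add: final_state_def matrix_vector_mult_def sum_UNIV_bool3 UNIV_bool tensor_def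
      phase_def ghz_def axis_def scaleR_conv_of_real[where 'a = complex] field_simps
      del: of_bool_eq_iff split del: if_split)

lemma norm_final_state: "norm (final_state (hadamard_err \<epsilon>) hadamard hadamard x) = 1"
proof -
  obtain x1 x2 x3 where x: "x = (x1, x2, x3)" by (cases x) auto
  define w where "w = exp (pi * \<i> * of_bool x1 / 2) * exp (pi * \<i> * of_bool x2 / 2) *
    exp (pi * \<i> * of_bool x3 / 2)"
  have "cmod w = 1" by (simp add: w_def norm_mult)
  then have w: "(Re w)\<^sup>2 + (Im w)\<^sup>2 = 1" by (simp flip: cmod_power2)
  define c s where "c = cos (pi / 4 + \<epsilon> / 2)" and "s = sin (pi / 4 + \<epsilon> / 2)"
  have cs: "c\<^sup>2 + s\<^sup>2 = 1" by (simp add: c_def s_def)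
  have h: "hadamard_err \<epsilon> $ i $ j = of_real (if i = j then (if i then - 1 else 1) * c else s)" for i j
    by (simp add: hadamard_err_def c_def s_def)
  have r: "complex_of_real (sqrt 2) * (complex_of_real (sqrt 2) * z) = 2 * z" for z
    by (simp flip: mult.assoc of_real_mult)
  have amp: "final_state (hadamard_err \<epsilon>) hadamard hadamard x $ (a1, a2, a3) =
      (of_real (if a1 then s else c) +
       w * of_real ((if a1 then - c else s) * (if a2 = a3 then 1 else - 1))) / (2 * sqrt 2)"
    for a1 a2 a3
    unfolding x final_state_nth w_def[symmetric]
    by (simp add: h hadamard_def field_simps r)
  have e: "(cmod (final_state (hadamard_err \<epsilon>) hadamard hadamard x $ (a1, a2, a3)))\<^sup>2 =
      (if a1 then (s + (if a2 = a3 then - c else c) * Re w)\<^sup>2 + (c * Im w)\<^sup>2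
       else (c + (if a2 = a3 then s else - s) * Re w)\<^sup>2 + (s * Im w)\<^sup>2) / 8" for a1 a2 a3
  proof -
    have "(cmod ((of_real p + w * of_real q) / (2 * sqrt 2)))\<^sup>2 =
        ((p + q * Re w)\<^sup>2 + (q * Im w)\<^sup>2) / 8" for p q :: real
      by (simp add: norm_divide norm_mult power_divide power_mult_distrib cmod_power2[of "_ + _"] mult.commute)
    from this[of "if a1 then s else c" "(if a1 then - c else s) * (if a2 = a3 then 1 else - 1)"]
    show ?thesis unfolding amp by (auto simp: power_mult_distrib)
  qed
  have "(\<Sum>a\<in>UNIV. (cmod (final_state (hadamard_err \<epsilon>) hadamard hadamard x $ a))\<^sup>2) =
      (c\<^sup>2 + s\<^sup>2) * (1 + ((Re w)\<^sup>2 + (Im w)\<^sup>2)) / 2"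
    unfolding sum_UNIV_bool3 e by (simp add: UNIV_bool power2_eq_square algebra_simps add_divide_distrib)
  then show ?thesis by (simp add: norm_vec_def L2_set_def w cs)
qed

end

theory Submission
  imports Defs
begin

text \<open>
  Under the promise the three phases multiply to 1 or -1, the latter exactly when the parity of a
  correct answer is odd. Hence the two branches of the GHZ state interfere with the same sign on
  every correct answer, whose amplitude is \<open>(c + s) / (2 sqrt 2)\<close>, where \<open>c\<close> and \<open>s\<close> are
  the cosine and sine entries of the erroneous Hadamard matrix. Four answers are correct, so the winning probability
  is \<open>(c + s)\<^sup>2 / 2 = 1 / 2 + s c\<close> for each question.
\<close>

text \<open>The promise leaves either no input bit set or exactly two; each set bit contributes a
  factor i, and i * i = -1.\<close>

lemma phase_product_promise:
  assumes "(x1, x2, x3) \<in> promise"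
  shows "exp (pi * \<i> * of_bool x1 / 2) * exp (pi * \<i> * of_bool x2 / 2) *
      exp (pi * \<i> * of_bool x3 / 2) = (if x1 \<or> x2 \<or> x3 then - 1 else 1)"
proof -
  have "exp (pi * \<i> / 2) = \<i>"
    using cis_conv_exp[of "pi / 2"] by (simp add: mult.commute)
  with assms show ?thesis
    by (cases x1; cases x2; cases x3) (auto simp: promise_def bxor_def)
qed

lemma pmf_strategy_correct:
  assumes "x \<in> promise" and "correct x a"
  shows "pmf (strategy (hadamard_err \<epsilon>) hadamard hadamard x) a =
      (cos (pi / 4 + \<epsilon> / 2) + sin (pi / 4 + \<epsilon> / 2))\<^sup>2 / 8"
proof -
  obtain x1 x2 x3 a1 a2 a3 where x: "x = (x1, x2, x3)" and a: "a = (a1, a2, a3)"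
    by (cases x; cases a) auto
  define c s where "c = cos (pi / 4 + \<epsilon> / 2)" and "s = sin (pi / 4 + \<epsilon> / 2)"
  have r: "complex_of_real (sqrt 2) * (complex_of_real (sqrt 2) * z) = 2 * z" for z
    by (simp flip: mult.assoc of_real_mult)
  \<comment> \<open>The \<open>True\<close> columns carry the sign (-1)^(a1+a2+a3), which cancels
    the phase product on a correct answer; flipping \<open>a1\<close> otherwise only swaps
    \<open>c\<close> and \<open>s\<close>.\<close>
  have "final_state (hadamard_err \<epsilon>) hadamard hadamard x $ a =
      of_real ((c + s) / (2 * sqrt 2))"
    using assms(2) unfolding x a final_state_nth phase_product_promise[OF assms(1)[unfolded x]]
    by (cases a1; cases a2; cases a3; cases "x1 \<or> x2 \<or> x3")
      (simp_all add: correct_def bxor_def hadamard_err_def hadamard_def r c_def s_def field_simps)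
  then have "(cmod (final_state (hadamard_err \<epsilon>) hadamard hadamard x $ a))\<^sup>2 =
      ((c + s) / (2 * sqrt 2))\<^sup>2"
    by (simp only: norm_of_real power2_abs)
  then show ?thesis
    by (simp add: strategy_def pmf_measurement norm_final_state power_divide power_mult_distrib
        c_def s_def)
qed

text \<open>A question fixes the parity of a correct answer, and half of the eight triples have that
  parity.\<close>

lemma card_correct: "card {a. correct x a} = 4"
proof -
  obtain x1 x2 x3 where x: "x = (x1, x2, x3)" by (cases x) auto
  have "card {a. correct x a} = (\<Sum>a\<in>UNIV. if correct x a then 1 else 0)"
    by (simp add: sum.If_cases)
  then show ?thesis
    unfolding sum_UNIV_bool3 by (simp add: x correct_def bxor_def UNIV_bool)
qed

lemma win_prob_hadamard_err:
  assumes "x \<in> promise"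
  shows "win_prob (strategy (hadamard_err \<epsilon>) hadamard hadamard) x =
      1 / 2 + sin (pi / 4 + \<epsilon> / 2) * cos (pi / 4 + \<epsilon> / 2)"
proof -
  define c s where "c = cos (pi / 4 + \<epsilon> / 2)" and "s = sin (pi / 4 + \<epsilon> / 2)"
  have cs: "c\<^sup>2 + s\<^sup>2 = 1" by (simp add: c_def s_def)
  have "win_prob (strategy (hadamard_err \<epsilon>) hadamard hadamard) x =
      (\<Sum>a | correct x a. (c + s)\<^sup>2 / 8)"
    using assms unfolding win_prob_def c_def s_def
    by (subst measure_measure_pmf_finite) (auto intro!: sum.cong simp: pmf_strategy_correct
        simp del: sum_constant)
  also have "\<dots> = (c\<^sup>2 + s\<^sup>2) / 2 + s * c"
    by (simp add: card_correct power2_sum)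
  finally show ?thesis by (simp add: cs c_def s_def)
qed

lemma win_prob_uniform_eqI:
  assumes "\<And>x. x \<in> promise \<Longrightarrow> win_prob S x = p"
  shows "win_prob_uniform S = p"
proof -
  have ne: "promise \<noteq> {}" by (auto simp: promise_def bxor_def)
  \<comment> \<open>Conditioning on the question: the slice of the winning event at \<open>x\<close>
    is the set of correct answers to \<open>x\<close>.\<close>
  have "win_prob_uniform S = measure_pmf.expectation (pmf_of_set promise) (win_prob S)"
    unfolding win_prob_uniform_def win_prob_def measure_pmf_bind
    by (subst measure_pmf.measure_bind[where N = "count_space UNIV"])
      (auto simp: vimage_def measure_pmf_in_subprob_algebra)
  also have "\<dots> = measure_pmf.expectation (pmf_of_set promise) (\<lambda>_. p)"
    \<comment> \<open>Almost everywhere means on the support, which is \<open>promise\<close>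
      because that set is finite and nonempty.\<close>
    using ne assms by (intro integral_cong_AE) (auto simp: AE_measure_pmf_iff)
  finally show ?thesis by simp
qed

theorem theorem3:
  fixes \<epsilon> :: real
  shows "(\<forall>x1 x2 x3. (x1, x2, x3) \<in> promise \<longrightarrow>
            win_prob (strategy (hadamard_err \<epsilon>) hadamard hadamard) (x1, x2, x3)
              = 1 / 2 + sin (pi / 4 + \<epsilon> / 2) * cos (pi / 4 + \<epsilon> / 2)) \<and>
         win_prob_uniform (strategy (hadamard_err \<epsilon>) hadamard hadamard)
              = 1 / 2 + sin (pi / 4 + \<epsilon> / 2) * cos (pi / 4 + \<epsilon> / 2)"
  by (simp add: win_prob_hadamard_err win_prob_uniform_eqI)

end
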